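(* Let $\{g_n\}_{n\ge1}$ be a sequence of real numbers, set $g_0=-1$, and let $\{x_n\}_{n\ge1}$ be the row sums of the general PI tree built from $\{g_n\}$, with $x_0=1$. Then for every $n\ge1$: \[ x_n=\sum_{\pi\in\mathcal{C}(n)} g_\pi=\sum_{p=1}^{n}\sum_{\substack{k_1+\dots+k_p=n\\ k_i\ge1}} g_{k_1}\cdots g_{k_p}, \qquad x_n=\sum_{p=1}^{n}\binom{n+1}{p+1}\sum_{\substack{k_1+\dots+k_p=n\\ k_i\ge0}} g_{k_1}\cdots g_{k_p}. \] Conversely, for every $n\ge1$, \[ g_n=\sum_{\pi\in\mathcal{C}(n)}(-1)^{|\pi|+1}x_\pi=\sum_{p=1}^{n}(-1)^{p+1}\sum_{\substack{k_1+\dots+k_p=n\\ k_i\ge1}} x_{k_1}\cdots x_{k_p}, \qquad g_n=\sum_{p=1}^{n}(-1)^{p+1}\binom{n+1}{p+1}\sum_{\substack{k_1+\dots+k_p=n\\ k_i\ge0}} x_{k_1}\cdots x_{k_p}. \]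
   Context: General PI tree (Fuchs): given an input sequence $\{g_n\}_{n\ge1}$, build a binary tree whose nodes are words $g_{i_1}g_{i_2}\cdots g_{i_k}$ in the (noncommuting, during construction) symbols $g_i$. The root (row 1) is $g_1$. Each node $g_{i_1}g_{i_2}\cdots g_{i_k}$ has two children: $g_1g_{i_1}g_{i_2}\cdots g_{i_k}$ (operator $P$, "put a 1") and $g_{i_1+1}g_{i_2}\cdots g_{i_k}$ (operator $I$, "increase"). Row $n$ thus contains $2^{n-1}$ words; the row sum $x_n$ is the sum over the words of row $n$ of the corresponding products of the real numbers $g_i$. A composition of $n\ge1$ is a sequence $\pi=(n_1,\dots,n_m)$ of integers $n_i\ge1$ summing to $n$; $\mathcal{C}(n)$ is the set of compositions of $n$, $|\pi|=m$, and $g_\pi=g_{n_1}\cdots g_{n_m}$ (similarly $x_\pi$). *)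

theory Defs
  imports Complex_Main
begin

text \<open>The word \<open>g\<^bsub>i1\<^esub> g\<^bsub>i2\<^esub> \<dots> g\<^bsub>ik\<^esub>\<close> is represented by its list of indices
  \<open>[i1, i2, \<dots>, ik]\<close>.\<close>

definition put_one :: "nat list \<Rightarrow> nat list" where
  "put_one w = 1 # w"

text \<open>The clause for the empty word is a dummy: every node of the tree is a nonempty word
  (\<open>Nil_notin_pi_row\<close> below).\<close>

fun increase :: "nat list \<Rightarrow> nat list" where
  "increase [] = []"
| "increase (i # w) = (i + 1) # w"

text \<open>\<open>pi_row n\<close> lists the nodes of row \<open>n\<close> from left to right, with multiplicity.
  Rows are numbered from 1, so the root is \<open>pi_row 1\<close>, and there is no row 0.\<close>

fun pi_row :: "nat \<Rightarrow> nat list list" where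
  "pi_row 0 = []"
| "pi_row (Suc 0) = [[1]]"
| "pi_row (Suc (Suc n)) = concat (map (\<lambda>w. [put_one w, increase w]) (pi_row (Suc n)))"

definition word_prod :: "(nat \<Rightarrow> real) \<Rightarrow> nat list \<Rightarrow> real" where
  "word_prod g w = (\<Prod>i\<leftarrow>w. g i)"

definition pi_row_sum :: "(nat \<Rightarrow> real) \<Rightarrow> nat \<Rightarrow> real" where
  "pi_row_sum g n = (\<Sum>w\<leftarrow>pi_row n. word_prod g w)"

definition compositions :: "nat \<Rightarrow> nat list set" where
  "compositions n = {\<pi>. (\<forall>i\<in>set \<pi>. i \<ge> 1) \<and> sum_list \<pi> = n}"

lemma Nil_notin_pi_row: "[] \<notin> set (pi_row n)"
proof (induction n rule: pi_row.induct)
  case (3 n)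
  have "increase w = [] \<longleftrightarrow> w = []" for w
    by (cases w) simp_all
  then have "[] \<notin> set (concat (map (\<lambda>w. [put_one w, increase w]) ws))" if "[] \<notin> set ws" for ws
    using that by (induction ws) (simp_all add: put_one_def eq_commute[of "[]"])
  with 3 show ?case by simp
qed simp_all

lemma length_pi_row: "n \<ge> 1 \<Longrightarrow> length (pi_row n) = 2 ^ (n - 1)"
proof (induction n rule: pi_row.induct)
  case (3 n)
  have "length (concat (map (\<lambda>w. [put_one w, increase w]) ws)) = 2 * length ws" for ws
    by (induction ws) simp_all
  with 3 show ?case by simp
qed simp_all

lemma finite_length_sum_list: "finite {ks :: nat list. length ks = p \<and> sum_list ks = n}"
proof (rule finite_subset)
  show "{ks. length ks = p \<and> sum_list ks = n} \<subseteq> {ks. set ks \<subseteq> {..n} \<and> length ks = p}"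
    by (auto intro: member_le_sum_list)
qed (rule finite_lists_length_eq, simp)

lemma finite_compositions: "finite (compositions n)"
proof (rule finite_subset)
  have "length \<pi> \<le> sum_list \<pi>" if "\<forall>i\<in>set \<pi>. i \<ge> 1" for \<pi> :: "nat list"
    using that by (induction \<pi>) simp_all
  then show "compositions n \<subseteq> {xs. set xs \<subseteq> {..n} \<and> length xs \<le> n}"
    by (auto simp: compositions_def intro: member_le_sum_list)
qed (rule finite_lists_length_le, simp)

end

theory Submission
  imports Defs "HOL-Computational_Algebra.Formal_Power_Series"
begin

unbundle fps_syntax

text \<open>Every composition of \<open>n + 1\<close> with \<open>n \<ge> 1\<close> arises exactly once from a composition of \<open>n\<close>,
  by prepending a 1 or by increasing the first part, so row \<open>n\<close> of the tree lists \<open>\<C>(n)\<close>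
  without repetition. For the power series \<open>G = \<Sum>\<^sub>n\<^sub>\<ge>\<^sub>0 g\<^sub>n t\<^sup>n\<close> and \<open>X = \<Sum>\<^sub>n\<^sub>\<ge>\<^sub>0 x\<^sub>n t\<^sup>n\<close> this says that
  \<open>X\<close> is the inverse of \<open>-G\<close>. All formulas are then instances of two expansions of the inverse
  \<open>B\<close> of a series \<open>A\<close> with constant term 1. As \<open>(1 - A)\<^sup>n\<^sup>+\<^sup>1\<close> has order greater than \<open>n\<close>, the
  coefficient of \<open>t\<^sup>n\<close> in \<open>B\<close> is that of \<open>\<Sum>\<^sub>p\<^sub>\<le>\<^sub>n (1 - A)\<^sup>p\<close> (a sum over compositions) and,
  by the binomial expansion of \<open>(1 - A)\<^sup>n\<^sup>+\<^sup>1\<close>, also that of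
  \<open>\<Sum>\<^sub>p\<^sub>\<le>\<^sub>n (-1)\<^sup>p (n + 1 choose p + 1) A\<^sup>p\<close>.\<close>

section \<open>Compositions and the rows of the tree\<close>

lemma compositions_Suc_Suc:
  "compositions (Suc (Suc n)) = put_one ` compositions (Suc n) \<union> increase ` compositions (Suc n)"
proof (intro equalityI subsetI)
  fix w assume w: "w \<in> compositions (Suc (Suc n))"
  then obtain i v where iv: "w = i # v" "i \<ge> 1"
    by (cases w) (auto simp: compositions_def)
  show "w \<in> put_one ` compositions (Suc n) \<union> increase ` compositions (Suc n)"
  proof (cases "i = 1")
    case True
    with w iv have "w = put_one v" "v \<in> compositions (Suc n)"
      by (auto simp: compositions_def put_one_def)
    then show ?thesis by blast
  next
    case False
    with w iv have "w = increase ((i - 1) # v)" "(i - 1) # v \<in> compositions (Suc n)"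
      by (auto simp: compositions_def)
    then show ?thesis by blast
  qed
next
  fix w assume "w \<in> put_one ` compositions (Suc n) \<union> increase ` compositions (Suc n)"
  then obtain v where "v \<in> compositions (Suc n)" "w = put_one v \<or> w = increase v"
    by blast
  then show "w \<in> compositions (Suc (Suc n))"
    by (cases v) (auto simp: compositions_def put_one_def)
qed

lemma compositions_1: "compositions (Suc 0) = {[1]}"
proof (intro equalityI subsetI)
  fix w assume w: "w \<in> compositions (Suc 0)"
  then obtain i v where "w = i # v" "i \<ge> 1"
    by (cases w) (auto simp: compositions_def)
  with w show "w \<in> {[1]}"
    by (cases v) (auto simp: compositions_def)
qed (simp add: compositions_def)

text \<open>Induction along the rows. The summand must stay arbitrary: the step applies the
  hypothesis to \<open>\<lambda>w. f (put_one w) + f (increase w)\<close>.\<close>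

lemma sum_list_pi_row:
  fixes f :: "nat list \<Rightarrow> real"
  shows "(\<Sum>w\<leftarrow>pi_row (Suc n). f w) = (\<Sum>w\<in>compositions (Suc n). f w)"
proof (induction n arbitrary: f)
  case 0
  show ?case by (simp add: compositions_1)
next
  case (Suc n)
  let ?C = "compositions (Suc n)"
  have row: "(\<Sum>w\<leftarrow>concat (map (\<lambda>w. [put_one w, increase w]) ws). f w)
      = (\<Sum>w\<leftarrow>ws. f (put_one w) + f (increase w))" for ws
    by (induction ws) simp_all
  have shape: "\<exists>i v. w = i # v \<and> i \<ge> 1" if "w \<in> ?C" for w
    using that by (cases w) (auto simp: compositions_def)
  have inj1: "inj_on put_one ?C"
    by (simp add: inj_on_def put_one_def)
  have inj2: "inj_on increase ?C"
  proof (rule inj_onI)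
    fix v w assume vw: "v \<in> ?C" "w \<in> ?C" "increase v = increase w"
    then obtain i j v' w' where "v = i # v'" "w = j # w'"
      using shape by meson
    with vw show "v = w" by simp
  qed
  \<comment> \<open>The first part is 1 on the left and, since parts are positive, at least 2 on the
    right.\<close>
  have disj: "put_one ` ?C \<inter> increase ` ?C = {}"
    using shape by (fastforce simp: put_one_def)
  have "(\<Sum>w\<leftarrow>pi_row (Suc (Suc n)). f w) = (\<Sum>w\<in>?C. f (put_one w) + f (increase w))"
    by (simp only: pi_row.simps row Suc.IH)
  also have "\<dots> = (\<Sum>w\<in>put_one ` ?C. f w) + (\<Sum>w\<in>increase ` ?C. f w)"
    by (simp add: sum.distrib sum.reindex inj1 inj2)
  also have "\<dots> = (\<Sum>w\<in>compositions (Suc (Suc n)). f w)"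
    unfolding compositions_Suc_Suc
    by (rule sum.union_disjoint[symmetric]) (simp_all add: finite_compositions disj)
  finally show ?case .
qed

lemma sum_compositions_by_length:
  fixes f :: "nat list \<Rightarrow> real"
  assumes "n \<ge> 1"
  shows "(\<Sum>\<pi>\<in>compositions n. f \<pi>)
    = (\<Sum>p=1..n. \<Sum>ks | length ks = p \<and> sum_list ks = n \<and> (\<forall>k\<in>set ks. k \<ge> 1). f ks)"
proof -
  have le: "length \<pi> \<le> sum_list \<pi>" if "\<forall>i\<in>set \<pi>. i \<ge> 1" for \<pi> :: "nat list"
    using that by (induction \<pi>) simp_all
  \<comment> \<open>Length 0 is excluded because the empty list sums to 0 and
    \<open>n \<ge> 1\<close>.\<close>
  have "length ` compositions n \<subseteq> {1..n}"
    using assms le by (auto simp: compositions_def Suc_le_eq)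
  then have "(\<Sum>\<pi>\<in>compositions n. f \<pi>)
      = (\<Sum>p=1..n. \<Sum>ks\<in>{ks \<in> compositions n. length ks = p}. f ks)"
    by (intro sum.group[symmetric] finite_compositions) simp_all
  also have "\<dots> = (\<Sum>p=1..n. \<Sum>ks | length ks = p \<and> sum_list ks = n \<and> (\<forall>k\<in>set ks. k \<ge> 1). f ks)"
    by (intro sum.cong refl) (auto simp: compositions_def)
  finally show ?thesis .
qed

section \<open>Coefficients of powers as sums over lists\<close>

lemma word_prod_nth: "word_prod g ks = (\<Prod>i<length ks. g (ks ! i))"
  by (simp add: word_prod_def prod.list_conv_set_nth atLeast0LessThan)

lemma fps_power_nth_lists:
  fixes a :: "nat \<Rightarrow> real"
  assumes "p \<ge> 1"
  shows "(Abs_fps a ^ p) $ n = (\<Sum>ks | length ks = p \<and> sum_list ks = n. \<Prod>i<p. a (ks ! i))"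
proof -
  \<comment> \<open>The successor form turns the index range from 0 to \<open>p - 1\<close> into
    \<open>i < p\<close>.\<close>
  from assms obtain q where "p = Suc q" by (cases p) auto
  then show ?thesis
    by (simp add: fps_power_nth natpermute_def atLeast0AtMost lessThan_Suc_atMost conj_commute
        del: power_Suc)
qed

lemma fps_power_nth_pos_lists:
  fixes a :: "nat \<Rightarrow> real"
  assumes "p \<ge> 1" "c 0 = 0" "\<And>k. k \<ge> 1 \<Longrightarrow> c k = a k"
  shows "(Abs_fps c ^ p) $ n
    = (\<Sum>ks | length ks = p \<and> sum_list ks = n \<and> (\<forall>k\<in>set ks. k \<ge> 1). \<Prod>i<p. a (ks ! i))"
  unfolding fps_power_nth_lists[OF assms(1)]
proof (rule sum.mono_neutral_cong_right)
  show "finite {ks :: nat list. length ks = p \<and> sum_list ks = n}"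
    by (rule finite_length_sum_list)
  show "\<forall>ks\<in>{ks. length ks = p \<and> sum_list ks = n}
      - {ks. length ks = p \<and> sum_list ks = n \<and> (\<forall>k\<in>set ks. k \<ge> 1)}. (\<Prod>i<p. c (ks ! i)) = 0"
  proof
    fix ks assume "ks \<in> {ks. length ks = p \<and> sum_list ks = n}
      - {ks. length ks = p \<and> sum_list ks = n \<and> (\<forall>k\<in>set ks. k \<ge> 1)}"
    then obtain k where "k \<in> set ks" "k = 0" "length ks = p" by (auto simp: not_le)
    then obtain i where "i < p" "ks ! i = 0" by (auto simp: in_set_conv_nth)
    then show "(\<Prod>i<p. c (ks ! i)) = 0"
      using assms(2) by (auto intro!: prod_zero bexI[of _ i])
  qed
qed (auto intro!: prod.cong simp: assms(3))

section \<open>Two expansions of an inverse series\<close>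

lemma fps_mult_power_Suc_nth_eq_0:
  fixes B C :: "real fps"
  assumes "C $ 0 = 0"
  shows "(B * C ^ Suc n) $ n = 0"
  using startsby_zero_power_prefix[OF assms, of "Suc n"]
  by (simp add: fps_mult_nth del: power_Suc)

text \<open>Writing the sign as a constant series lets it be pulled out of a coefficient.\<close>

lemma fps_minus_power:
  fixes C :: "real fps"
  shows "(- C) ^ p = fps_const ((-1) ^ p) * C ^ p"
  by (cases "even p") (simp_all flip: fps_const_neg)

lemma fps_inverse_nth_geometric:
  fixes A B :: "real fps"
  assumes "A $ 0 = 1" "B * A = 1" "n \<ge> 1"
  shows "B $ n = (\<Sum>p=1..n. ((1 - A) ^ p) $ n)"
proof -
  have zero: "(B * (1 - A) ^ Suc n) $ n = 0"
    by (rule fps_mult_power_Suc_nth_eq_0) (simp add: assms(1))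
  \<comment> \<open>Inserting \<open>B * A = 1\<close> supplies the factor
    \<open>A = 1 - (1 - A)\<close>, against which the geometric sum telescopes.\<close>
  have "(\<Sum>p<Suc n. (1 - A) ^ p) = B * (A * (\<Sum>p<Suc n. (1 - A) ^ p))"
    using assms(2) by (simp only: mult.assoc[symmetric] mult_1_left)
  also have "A * (\<Sum>p<Suc n. (1 - A) ^ p) = 1 - (1 - A) ^ Suc n"
    using one_diff_power_eq[of "1 - A" "Suc n"] by simp
  finally have "B = (\<Sum>p<Suc n. (1 - A) ^ p) + B * (1 - A) ^ Suc n"
    by (simp add: right_diff_distrib del: power_Suc)
  then have "B $ n = (\<Sum>p<Suc n. ((1 - A) ^ p) $ n)"
    using zero by (metis fps_add_nth fps_sum_nth add_0_right)
  \<comment> \<open>The term \<open>p = 0\<close> is the series 1, whose coefficient at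
    \<open>n \<ge> 1\<close> is 0.\<close>
  also have "\<dots> = (\<Sum>p=1..n. ((1 - A) ^ p) $ n)"
    using assms(3) by (intro sum.mono_neutral_right) (auto simp: not_le)
  finally show ?thesis .
qed

text \<open>In \<open>B * (1 - A) ^ Suc n\<close>, the binomial term of degree 0 in \<open>A\<close>
  contributes \<open>B\<close>, and in every other term \<open>B\<close> cancels one factor
  \<open>A\<close>. This shift of the exponent is why \<open>p + 1\<close> stands in the binomial
  coefficient.\<close>

lemma fps_inverse_nth_binomial:
  fixes A B :: "real fps"
  assumes "A $ 0 = 1" "B * A = 1" "n \<ge> 1"
  shows "B $ n = (\<Sum>p=1..n. (-1) ^ p * real ((n + 1) choose (p + 1)) * (A ^ p) $ n)"
proof -
  have zero: "(B * (1 - A) ^ Suc n) $ n = 0"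
    by (rule fps_mult_power_Suc_nth_eq_0) (simp add: assms(1))
  define c where "c q = fps_const ((-1) ^ q * real (Suc n choose q))" for q
  have c: "of_nat (Suc n choose q) * (- A) ^ q = c q * A ^ q" for q
    by (simp only: c_def fps_minus_power fps_of_nat[symmetric] fps_const_mult[symmetric] mult_ac)
  have BA: "B * (c (Suc p) * A ^ Suc p) = c (Suc p) * A ^ p" for p
  proof -
    have "B * (c (Suc p) * A ^ Suc p) = (B * A) * (c (Suc p) * A ^ p)"
      by (simp add: mult_ac)
    then show ?thesis by (simp add: assms(2))
  qed
  have "(1 - A) ^ Suc n = (\<Sum>q\<le>Suc n. c q * A ^ q)"
    using binomial_ring[of "- A" 1 "Suc n"]
    by (simp add: c del: power_Suc binomial_Suc_Suc sum.atMost_Suc)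
  also have "\<dots> = 1 + (\<Sum>p\<le>n. c (Suc p) * A ^ Suc p)"
    by (subst sum.atMost_Suc_shift) (simp add: c_def)
  finally have "B * (1 - A) ^ Suc n = B + (\<Sum>p\<le>n. c (Suc p) * A ^ p)"
    by (simp add: distrib_left sum_distrib_left BA del: power_Suc)
  with zero have "B $ n + (\<Sum>p\<le>n. (c (Suc p) * A ^ p) $ n) = 0"
    by (metis fps_add_nth fps_sum_nth)
  \<comment> \<open>Moving the sum across turns the sign \<open>(-1) ^ Suc p\<close> into
    \<open>(-1) ^ p\<close>.\<close>
  then have "B $ n = (\<Sum>p\<le>n. - ((c (Suc p) * A ^ p) $ n))"
    by (simp add: sum_negf)
  also have "\<dots> = (\<Sum>p\<le>n. (-1) ^ p * real ((n + 1) choose (p + 1)) * (A ^ p) $ n)"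
    by (simp add: c_def del: binomial_Suc_Suc)
  also have "\<dots> = (\<Sum>p=1..n. (-1) ^ p * real ((n + 1) choose (p + 1)) * (A ^ p) $ n)"
    using assms(3) by (intro sum.mono_neutral_right) (auto simp: not_le)
  finally show ?thesis .
qed

section \<open>Inversion between \<open>g\<close> and \<open>x\<close>\<close>

theorem theorem6:
  fixes g x :: "nat \<Rightarrow> real" and n :: nat
  assumes "g 0 = -1"
    and "x 0 = 1"
    and "\<And>m. m \<ge> 1 \<Longrightarrow> x m = pi_row_sum g m"
    and "n \<ge> 1"
  shows "x n = (\<Sum>\<pi>\<in>compositions n. word_prod g \<pi>)
    \<and> (\<Sum>\<pi>\<in>compositions n. word_prod g \<pi>)
        = (\<Sum>p=1..n. \<Sum>ks | length ks = p \<and> sum_list ks = n \<and> (\<forall>k\<in>set ks. k \<ge> 1). \<Prod>i<p. g (ks ! i))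
    \<and> x n = (\<Sum>p=1..n. real ((n + 1) choose (p + 1)) *
               (\<Sum>ks | length ks = p \<and> sum_list ks = n. \<Prod>i<p. g (ks ! i)))
    \<and> g n = (\<Sum>\<pi>\<in>compositions n. (-1) ^ (length \<pi> + 1) * word_prod x \<pi>)
    \<and> (\<Sum>\<pi>\<in>compositions n. (-1) ^ (length \<pi> + 1) * word_prod x \<pi>)
        = (\<Sum>p=1..n. (-1) ^ (p + 1) *
             (\<Sum>ks | length ks = p \<and> sum_list ks = n \<and> (\<forall>k\<in>set ks. k \<ge> 1). \<Prod>i<p. x (ks ! i)))
    \<and> g n = (\<Sum>p=1..n. (-1) ^ (p + 1) * real ((n + 1) choose (p + 1)) *
               (\<Sum>ks | length ks = p \<and> sum_list ks = n. \<Prod>i<p. x (ks ! i)))"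
proof -
  \<comment> \<open>The sign makes the constant term 1, since \<open>g 0 = -1\<close>.\<close>
  define A where "A = Abs_fps (\<lambda>k. - g k)"
  define X where "X = Abs_fps x"
  have A0: "A $ 0 = 1" and X0: "X $ 0 = 1"
    using assms(1,2) by (simp_all add: A_def X_def)
  have comp_x: "x m = (\<Sum>\<pi>\<in>compositions m. word_prod g \<pi>)" if m: "m \<ge> 1" for m
  proof -
    obtain l where "m = Suc l" using m by (cases m) auto
    then show ?thesis
      using assms(3)[OF m] sum_list_pi_row[of "word_prod g" l] by (simp add: pi_row_sum_def)
  qed
  have by_parts: "(\<Sum>\<pi>\<in>compositions m. word_prod h \<pi>)
      = (\<Sum>p=1..m. \<Sum>ks | length ks = p \<and> sum_list ks = m \<and> (\<forall>k\<in>set ks. k \<ge> 1). \<Prod>i<p. h (ks ! i))"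
    if "m \<ge> 1" for m and h :: "nat \<Rightarrow> real"
    unfolding sum_compositions_by_length[OF that]
    by (intro sum.cong refl) (auto simp: word_prod_nth)
  have sign_parts: "(\<Sum>\<pi>\<in>compositions n. (-1) ^ (length \<pi> + 1) * word_prod x \<pi>)
      = (\<Sum>p=1..n. (-1) ^ (p + 1) *
          (\<Sum>ks | length ks = p \<and> sum_list ks = n \<and> (\<forall>k\<in>set ks. k \<ge> 1). \<Prod>i<p. x (ks ! i)))"
    unfolding sum_compositions_by_length[OF assms(4)] sum_distrib_left
    by (intro sum.cong refl) (auto simp: word_prod_nth)
  have pow_1_A: "((1 - A) ^ p) $ m
      = (\<Sum>ks | length ks = p \<and> sum_list ks = m \<and> (\<forall>k\<in>set ks. k \<ge> 1). \<Prod>i<p. g (ks ! i))"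
    if "p \<ge> 1" for p m
  proof -
    \<comment> \<open>The constant terms cancel: \<open>1 + g 0 = 0\<close>.\<close>
    have "1 - A = Abs_fps (\<lambda>k. if k = 0 then 0 else g k)"
      using assms(1) by (intro fps_ext) (simp add: A_def)
    then show ?thesis
      using fps_power_nth_pos_lists[OF that, of "\<lambda>k. if k = 0 then 0 else g k" g] by simp
  qed
  have pow_1_X: "((1 - X) ^ p) $ m = (-1) ^ p *
      (\<Sum>ks | length ks = p \<and> sum_list ks = m \<and> (\<forall>k\<in>set ks. k \<ge> 1). \<Prod>i<p. x (ks ! i))"
    if "p \<ge> 1" for p m
  proof -
    have "1 - X = - Abs_fps (\<lambda>k. if k = 0 then 0 else x k)"
      using assms(2) by (intro fps_ext) (simp add: X_def)
    then have "(1 - X) ^ p = fps_const ((-1) ^ p) * Abs_fps (\<lambda>k. if k = 0 then 0 else x k) ^ p"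
      by (simp only: fps_minus_power)
    then show ?thesis
      using fps_power_nth_pos_lists[OF that, of "\<lambda>k. if k = 0 then 0 else x k" x] by simp
  qed
  have pow_A: "(A ^ p) $ m = (-1) ^ p *
      (\<Sum>ks | length ks = p \<and> sum_list ks = m. \<Prod>i<p. g (ks ! i))" if "p \<ge> 1" for p m
  proof -
    have "A = - Abs_fps g"
      by (intro fps_ext) (simp add: A_def)
    then have "A ^ p = fps_const ((-1) ^ p) * Abs_fps g ^ p"
      by (simp only: fps_minus_power)
    then show ?thesis
      by (simp add: fps_power_nth_lists[OF that])
  qed
  \<comment> \<open>At index 0 both coefficients are 1. At a positive index the geometric expansion
    of \<open>inverse A\<close> is the sum over compositions that equals \<open>x m\<close>.\<close>
  have "X = inverse A"
  proof (rule fps_ext)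
    fix m
    show "X $ m = inverse A $ m"
    proof (cases "m \<ge> 1")
      case True
      have "inverse A * A = 1"
        by (rule inverse_mult_eq_1) (simp add: A0)
      from fps_inverse_nth_geometric[OF A0 this True] show ?thesis
        using comp_x[OF True] by_parts[OF True, of g] by (simp add: X_def pow_1_A)
    next
      case False
      then show ?thesis using A0 X0 by (simp add: not_le)
    qed
  qed
  \<comment> \<open>The roles are symmetric: \<open>XA\<close> expands \<open>X\<close> in powers of
    \<open>A\<close>, and \<open>AX\<close> expands \<open>A\<close> in powers of
    \<open>X\<close>.\<close>
  then have XA: "X * A = 1" and AX: "A * X = 1"
    using A0 by (simp_all add: inverse_mult_eq_1 inverse_mult_eq_1')
  have "x n = (\<Sum>p=1..n. real ((n + 1) choose (p + 1)) *
               (\<Sum>ks | length ks = p \<and> sum_list ks = n. \<Prod>i<p. g (ks ! i)))"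
  proof -
    have "(-1) ^ p * real ((n + 1) choose (p + 1)) * (A ^ p) $ n
      = real ((n + 1) choose (p + 1)) *
          (\<Sum>ks | length ks = p \<and> sum_list ks = n. \<Prod>i<p. g (ks ! i))" if "p \<in> {1..n}" for p
    proof -
      \<comment> \<open>One sign comes from the binomial expansion, the other from
        \<open>A = - Abs_fps g\<close>; they cancel.\<close>
      have sign: "(-1) ^ p * (b * ((-1) ^ p * s)) = b * s" for b s :: real
        by (cases "even p") simp_all
      have "p \<ge> 1" using that by simp
      then show ?thesis
        by (simp only: pow_A mult.assoc sign)
    qed
    then have "X $ n = (\<Sum>p=1..n. real ((n + 1) choose (p + 1)) *
          (\<Sum>ks | length ks = p \<and> sum_list ks = n. \<Prod>i<p. g (ks ! i)))"
      unfolding fps_inverse_nth_binomial[OF A0 XA assms(4)] by (rule sum.cong[OF refl])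
    then show ?thesis by (simp add: X_def)
  qed
  moreover have "g n = (\<Sum>p=1..n. (-1) ^ (p + 1) *
      (\<Sum>ks | length ks = p \<and> sum_list ks = n \<and> (\<forall>k\<in>set ks. k \<ge> 1). \<Prod>i<p. x (ks ! i)))"
  proof -
    \<comment> \<open>This minus sign raises the exponent of -1 from \<open>p\<close> to
      \<open>p + 1\<close>.\<close>
    have "g n = - (A $ n)" by (simp add: A_def)
    then show ?thesis
      unfolding fps_inverse_nth_geometric[OF X0 AX assms(4)]
      by (simp add: pow_1_X sum_negf)
  qed
  moreover have "g n = (\<Sum>p=1..n. (-1) ^ (p + 1) * real ((n + 1) choose (p + 1)) *
               (\<Sum>ks | length ks = p \<and> sum_list ks = n. \<Prod>i<p. x (ks ! i)))"
  proof -
    have "g n = - (A $ n)" by (simp add: A_def)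
    then show ?thesis
      unfolding fps_inverse_nth_binomial[OF X0 AX assms(4)]
      by (simp add: X_def fps_power_nth_lists sum_negf del: binomial_Suc_Suc)
  qed
  ultimately show ?thesis
    using comp_x[OF assms(4)] by_parts[OF assms(4), of g] sign_parts by (intro conjI) (simp_all only:)
qed

end
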